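(* Let $d \geq 4$ be an integer, let $\mathcal{E}'$ be the family of intervals in $\mathbb{R}^d$ defined in the context, and let $\mathcal{M}$ be the associated maximal operator $$\mathcal{M}f(x) = \sup_{R \in \mathcal{E}'} \frac{\mathbf{1}_R(x)}{|R|} \int_R |f(y)| \, dy.$$ Let $\alpha\in\mathbb{R}$ and suppose that there is a constant $C>0$ such that for all non-negative measurable functions $f$ on $\mathbb{R}^d$ $$|\{x \in \mathbb{R}^d:\, \mathcal{M}f(x) \geq 1\}| \leq C \int_{\mathbb{R}^d} f(x) \bigl(\log(e+f(x))\bigr)^{\alpha}\,dx .$$ Then $\alpha \geq d-2$.
   Context: Fix an integer $d \geq 4$. The family $\mathcal{E}'$ is constructed as follows. (1) For each integer $n \ge 0$ let $\beta_{n,(\cdot)}$ be a finite sequence enumerating, in some order and without repetition, all $(d-2)$-tuples $(m_1,\dots,m_{d-2}) \in \mathbb{Z}^{d-2}$ with $m_1+\dots+m_{d-2}=0$ and $0 \le m_j \le n$ for all $1 \le j \le d-3$. Let $(\beta_m)_{m\ge 0}$ be the single infinite sequence obtained by concatenating the finite sequences $\beta_{0,(\cdot)}, \beta_{1,(\cdot)}, \beta_{2,(\cdot)}, \dots$ in this order (so elements of $\mathbb{Z}^{d-2}$ may be repeated). (2) For $1 \le i \le d-2$ define $\varphi_i : \mathbb{Z} \to \mathbb{Z}$ by letting $\varphi_i(m)$ be the $i$-th coordinate of $\beta_m$ for $m \ge 0$, and $\varphi_i(m) = 0$ for $m<0$. Let $\Phi_i : \mathbb{Z}^2 \to \mathbb{Z}$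 be the function, non-decreasing in each variable and satisfying $\Phi_i(m,-m)=\varphi_i(m)$ for all $m\in\mathbb{Z}$, given by $$\Phi_i(m_1,m_2) = \max\{\varphi_i(m) : -m_2 \le m \le m_1\} \text{ if } m_1 \ge -m_2, \qquad \Phi_i(m_1,m_2) = \min\{\varphi_i(m) : m_1 \le m \le -m_2\} \text{ if } m_1 \le -m_2 .$$ (3) For real $s$ let $\tau(s) = |s|^{d-2}\operatorname{sign}(s)$, where $\operatorname{sign}(s)=1$ for $s>0$ and $-1$ for $s<0$, and $\tau(0)=0$; $\tau$ is a bijection of $\mathbb{R}$. (4) A dyadic interval in $\mathbb{R}^d$ of dimensions $2^{a_1}\times\dots\times 2^{a_d}$ (with $a_i$ real) is a set $\prod_{i=1}^d [j_i 2^{a_i}, (j_i+1)2^{a_i})$ with $j_i \in \mathbb{Z}$. Let $\mathcal{E}$ be the collection of all dyadic intervals $R$ in $\mathbb{R}^d$ with dimensions $$2^s \times 2^t \times 2^{\Phi_1(\tau(s),\tau(t))} \times \dots \times 2^{\Phi_{d-2}(\tau(s),\tau(t))}, \quad s,t \in \tau^{-1}(\mathbb{Z}).$$ (5) $\mathcal{E}'$ is the family of those $R \in \mathcal{E}$ with $|\pi_1(R)|\,|\pi_2(R)| = 1$, where $\pi_i(R)$ is the projection of $R$ onto the $i$-th coordinate axis and $|\pi_i(R)|$ its length (i.e. those with $s+t=0$). $|E|$ denotes the Lebesgue measure of $E$. *)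

theory Defs
  imports "HOL-Analysis.Analysis"
begin

text \<open>
  Points of \<open>\<real>\<^sup>d\<close> are vectors of type \<^typ>\<open>real^'n\<close>. The coordinates play different roles, so they are
  numbered by a bijection \<open>idx\<close> from \<open>{1..d}\<close> onto the index type: the \<open>i\<close>-th coordinate of \<open>x\<close> is
  \<open>x $ idx i\<close>. Integer tuples of length \<open>d - 2\<close> are extensional functions on \<open>{1..d-2}\<close>.
\<close>

definition zero_sum_tuples :: "nat \<Rightarrow> nat \<Rightarrow> (nat \<Rightarrow> int) set" where
  "zero_sum_tuples d n =
     {m \<in> {1..d-2} \<rightarrow>\<^sub>E UNIV. (\<Sum>j=1..d-2. m j) = 0 \<and> (\<forall>j\<in>{1..d-3}. 0 \<le> m j \<and> m j \<le> int n)}"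

definition block_enumeration :: "nat \<Rightarrow> (nat \<Rightarrow> (nat \<Rightarrow> int) list) \<Rightarrow> bool" where
  "block_enumeration d b \<longleftrightarrow> (\<forall>n. distinct (b n) \<and> set (b n) = zero_sum_tuples d n)"

text \<open>
  The infinite concatenation of the lists \<open>b 0\<close>, \<open>b 1\<close>, \<open>\<dots>\<close>. Every block contains the zero tuple, so
  the first \<open>m + 1\<close> blocks already have more than \<open>m\<close> entries; see \<open>beta_concat\<close> below.
\<close>

definition beta :: "(nat \<Rightarrow> (nat \<Rightarrow> int) list) \<Rightarrow> nat \<Rightarrow> (nat \<Rightarrow> int)" where
  "beta b m = concat (map b [0..<Suc m]) ! m"

definition phi :: "(nat \<Rightarrow> (nat \<Rightarrow> int) list) \<Rightarrow> nat \<Rightarrow> int \<Rightarrow> int" where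
  "phi b i m = (if 0 \<le> m then beta b (nat m) i else 0)"

definition Phi :: "(nat \<Rightarrow> (nat \<Rightarrow> int) list) \<Rightarrow> nat \<Rightarrow> int \<Rightarrow> int \<Rightarrow> int" where
  "Phi b i m1 m2 =
     (if - m2 \<le> m1 then Max (phi b i ` {- m2..m1}) else Min (phi b i ` {m1..- m2}))"

definition tau :: "nat \<Rightarrow> real \<Rightarrow> real" where
  "tau d s = \<bar>s\<bar> ^ (d - 2) * sgn s"

definition dyadic_intervals :: "nat \<Rightarrow> (nat \<Rightarrow> 'n) \<Rightarrow> (nat \<Rightarrow> real) \<Rightarrow> (real^'n) set set" where
  "dyadic_intervals d idx a =
     {R. \<exists>j :: nat \<Rightarrow> int. R = {x. \<forall>i\<in>{1..d}.
        x $ idx i \<in> {of_int (j i) * 2 powr a i ..< (of_int (j i) + 1) * 2 powr a i}}}"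

text \<open>
  The logarithms of the side lengths. The floors are only used where \<open>tau d s\<close> and \<open>tau d t\<close> are
  integers, and there they merely convert from \<^typ>\<open>real\<close> to \<^typ>\<open>int\<close>.
\<close>

definition log_dims :: "nat \<Rightarrow> (nat \<Rightarrow> (nat \<Rightarrow> int) list) \<Rightarrow> real \<Rightarrow> real \<Rightarrow> nat \<Rightarrow> real" where
  "log_dims d b s t i =
     (if i = 1 then s else if i = 2 then t
      else of_int (Phi b (i - 2) \<lfloor>tau d s\<rfloor> \<lfloor>tau d t\<rfloor>))"

definition family_E ::
  "nat \<Rightarrow> (nat \<Rightarrow> 'n) \<Rightarrow> (nat \<Rightarrow> (nat \<Rightarrow> int) list) \<Rightarrow> (real^'n) set set" where
  "family_E d idx b =
     (\<Union>s \<in> {s. tau d s \<in> \<int>}. \<Union>t \<in> {t. tau d t \<in> \<int>}. dyadic_intervals d idx (log_dims d b s t))"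

definition family_E' ::
  "nat \<Rightarrow> (nat \<Rightarrow> 'n) \<Rightarrow> (nat \<Rightarrow> (nat \<Rightarrow> int) list) \<Rightarrow> (real^'n) set set" where
  "family_E' d idx b =
     {R \<in> family_E d idx b.
        measure lebesgue ((\<lambda>x. x $ idx 1) ` R) * measure lebesgue ((\<lambda>x. x $ idx 2) ` R) = 1}"

definition maximal_op ::
  "(real^'n) set set \<Rightarrow> (real^'n \<Rightarrow> real) \<Rightarrow> real^'n \<Rightarrow> ennreal" where
  "maximal_op F f x =
     (SUP R\<in>F. indicator R x / emeasure lebesgue R * (\<integral>\<^sup>+y\<in>R. ennreal \<bar>f y\<bar> \<partial>lebesgue))"

lemma zero_sum_tuples_nonempty: "zero_sum_tuples d n \<noteq> {}"
proof -
  have "restrict (\<lambda>_. 0) {1..d-2} \<in> zero_sum_tuples d n"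
    by (auto simp: zero_sum_tuples_def)
  then show ?thesis by blast
qed

lemma beta_concat:
  assumes b: "block_enumeration d b" and m: "m < length (concat (map b [0..<n]))"
  shows "beta b m = concat (map b [0..<n]) ! m"
proof -
  have ne: "length (b k) > 0" for k
  proof -
    have "set (b k) \<noteq> {}"
      using b zero_sum_tuples_nonempty[of d k] unfolding block_enumeration_def by simp
    then show ?thesis by simp
  qed
  have len: "k \<le> length (concat (map b [0..<k]))" for k
  proof (induction k)
    case (Suc k)
    then show ?case using ne[of k] by (simp del: length_greater_0_conv)
  qed simp
  have pre: "concat (map b [0..<l]) ! i = concat (map b [0..<k]) ! i"
    if "k \<le> l" "i < length (concat (map b [0..<k]))" for i k l
  proof -
    obtain r where "l = k + r" using \<open>k \<le> l\<close> le_Suc_ex by blast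
    then have "[0..<l] = [0..<k] @ [k..<l]" using upt_add_eq_append[of 0 k r] by simp
    then show ?thesis using that(2) by (simp only: map_append concat_append nth_append if_True)
  qed
  show ?thesis
  proof (cases "Suc m \<le> n")
    case True
    have "m < length (concat (map b [0..<Suc m]))" using len[of "Suc m"] by linarith
    from pre[OF True this] show ?thesis unfolding beta_def by (rule sym)
  next
    case False
    then have "n \<le> Suc m" by simp
    from pre[OF this m] show ?thesis unfolding beta_def .
  qed
qed

end

theory Submission
  imports Defs
begin

text \<open>
  Test the inequality on a cube \<open>Q\<close> of side \<open>2\<^sup>-\<^sup>d\<^sup>n\<close> at the origin, with \<open>f\<close> the normalised indicator of \<open>Q\<close>.
  The right-hand side is then of order \<open>n\<^sup>\<alpha>\<close>. Every rectangle of the family has volume 1, so the level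
  set contains every rectangle with a corner at the origin that contains \<open>Q\<close>. Since the first
  \<open>k\<close> blocks have about \<open>k\<^sup>d\<^sup>-\<^sup>2\<close> entries, \<open>s = m\<^bsup>1/(d-2)\<^esup>\<close> grows linearly in the block number, and \<open>n\<close>
  well-spaced blocks of number \<open>O(n)\<close> give values of \<open>s\<close> at mutual distance at least 1. Combined with the
  \<open>(n+1)\<^sup>d\<^sup>-\<^sup>3\<close> tuples of block \<open>n\<close>, which recur in all later blocks, this gives at least \<open>n\<^sup>d\<^sup>-\<^sup>2\<close>
  rectangles. Their upper dyadic halves in all coordinates are pairwise disjoint and have measure
  \<open>2\<^sup>-\<^sup>d\<close>, so \<open>n\<^sup>d\<^sup>-\<^sup>2\<close> is at most a constant times \<open>n\<^sup>\<alpha>\<close>.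
\<close>

section \<open>Counting tuples and locating them in the sequence\<close>

text \<open>The first \<open>d - 3\<close> entries range freely over \<open>{0..int n}\<close> and
  the last is minus their sum, so restriction to \<open>{1..d-3}\<close> is a bijection onto a
  product set.\<close>

lemma card_zero_sum_tuples:
  assumes "d \<ge> 3"
  shows "card (zero_sum_tuples d n) = (n + 1) ^ (d - 3)"
proof -
  let ?I = "{1..d-3}"
  let ?P = "?I \<rightarrow>\<^sub>E {0..int n}"
  let ?r = "\<lambda>m :: nat \<Rightarrow> int. restrict m ?I"
  let ?g = "\<lambda>f :: nat \<Rightarrow> int. \<lambda>j. if j \<in> ?I then f j else if j = d - 2 then - sum f ?I else undefined"
  have I: "{1..d-2} = insert (d - 2) ?I" and nI: "d - 2 \<notin> ?I"
    using assms by auto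
  have split: "sum m {1..d-2} = m (d - 2) + sum m ?I" for m :: "nat \<Rightarrow> int"
    unfolding I using nI by simp
  have "bij_betw ?r (zero_sum_tuples d n) ?P"
  proof (rule bij_betw_byWitness[where f' = ?g])
    show "\<forall>m\<in>zero_sum_tuples d n. ?g (?r m) = m"
    proof (intro ballI ext)
      fix m j assume m: "m \<in> zero_sum_tuples d n"
      then have "m (d - 2) + sum m ?I = 0"
        using split[of m] by (simp add: zero_sum_tuples_def)
      moreover have "m j = undefined" if "j \<notin> ?I" "j \<noteq> d - 2"
        using m that I by (auto simp: zero_sum_tuples_def PiE_def extensional_def)
      ultimately show "?g (?r m) j = m j" by auto
    qed
    show "\<forall>f\<in>?P. ?r (?g f) = f"
      by (auto simp: fun_eq_iff PiE_def extensional_def)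
    show "?r ` zero_sum_tuples d n \<subseteq> ?P"
      by (auto simp: zero_sum_tuples_def)
    show "?g ` ?P \<subseteq> zero_sum_tuples d n"
    proof (rule image_subsetI)
      fix f assume f: "f \<in> ?P"
      have "sum (?g f) ?I = sum f ?I" by (rule sum.cong) auto
      then have "sum (?g f) {1..d-2} = 0"
        unfolding split using nI I by auto
      moreover have "?g f \<in> {1..d-2} \<rightarrow>\<^sub>E UNIV"
        unfolding I by (auto simp: PiE_def extensional_def)
      moreover have "\<forall>j\<in>?I. 0 \<le> ?g f j \<and> ?g f j \<le> int n"
        using f by (auto simp: PiE_def Pi_def)
      ultimately show "?g f \<in> zero_sum_tuples d n"
        by (simp add: zero_sum_tuples_def)
    qed
  qed
  then show ?thesis
    by (simp add: bij_betw_same_card card_PiE nat_add_distrib)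
qed

lemma length_concat_blocks:
  assumes "d \<ge> 3" "block_enumeration d b"
  shows "length (concat (map b [0..<k])) = (\<Sum>j<k. (j + 1) ^ (d - 3))"
proof -
  have "length (b j) = (j + 1) ^ (d - 3)" for j
    using assms card_zero_sum_tuples[of d j] distinct_card[of "b j"]
    unfolding block_enumeration_def by simp
  then show ?thesis by (induction k) auto
qed

text \<open>Block \<open>k\<close> lists all of \<open>zero_sum_tuples d k\<close> right after the
  earlier blocks, whose total length is the power sum on the left. The order within the block is
  arbitrary, so only this window for the index is available.\<close>

lemma beta_position:
  assumes "d \<ge> 3" "block_enumeration d b" "\<tau> \<in> zero_sum_tuples d k"
  obtains m where "(\<Sum>j<k. (j + 1) ^ (d - 3)) \<le> m" "m < (\<Sum>j<Suc k. (j + 1) ^ (d - 3))" "beta b m = \<tau>"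
proof -
  let ?L = "\<lambda>k. length (concat (map b [0..<k]))"
  obtain i where i: "i < length (b k)" "b k ! i = \<tau>"
    using assms unfolding block_enumeration_def by (metis in_set_conv_nth)
  have "?L k + i < ?L (Suc k)" using i by simp
  moreover from this have "beta b (?L k + i) = \<tau>"
    using beta_concat[OF assms(2), of "?L k + i" "Suc k"] i by (simp add: nth_append)
  ultimately show thesis
    using that[of "?L k + i"] unfolding length_concat_blocks[OF assms(1,2)] by simp
qed

section \<open>Growth and spacing of the roots of the indices\<close>

lemma sum_power_le: "(\<Sum>j<k. (j + 1) ^ p) \<le> (k::nat) ^ Suc p"
proof -
  have "(\<Sum>j<k. (j + 1) ^ p) \<le> of_nat (card {..<k}) * k ^ p"
    by (rule sum_bounded_above) (auto intro: power_mono)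
  then show ?thesis by simp
qed

text \<open>At least \<open>q\<close> whole blocks lie strictly between blocks \<open>k\<close> and
  \<open>k'\<close>, and each has length at least \<open>(k + 2) ^ p\<close>.\<close>

lemma sum_power_gap:
  fixes k k' p q :: nat
  assumes "k + q + 1 \<le> k'"
  shows "(\<Sum>j<Suc k. (j + 1) ^ p) + q * (k + 2) ^ p \<le> (\<Sum>j<k'. (j + 1) ^ p)"
proof -
  have "of_nat (card {Suc k..<k'}) * (k + 2) ^ p \<le> (\<Sum>j\<in>{Suc k..<k'}. (j + 1) ^ p)"
    by (rule sum_bounded_below) (auto intro: power_mono)
  moreover have "q * (k + 2) ^ p \<le> of_nat (card {Suc k..<k'}) * (k + 2) ^ p"
    using assms by (intro mult_right_mono) auto
  moreover have "(\<Sum>j<k'. (j + 1) ^ p) = (\<Sum>j<Suc k. (j + 1) ^ p) + (\<Sum>j\<in>{Suc k..<k'}. (j + 1) ^ p)"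
    using assms unfolding lessThan_atLeast0
    by (intro sum.atLeastLessThan_concat[symmetric]) auto
  ultimately show ?thesis by linarith
qed

text \<open>The mean value bound for the increment of a power, obtained by induction.\<close>

lemma power_Suc_diff_le:
  fixes x :: real
  assumes "x \<ge> 0"
  shows "(x + 1) ^ Suc n \<le> x ^ Suc n + Suc n * (x + 1) ^ n"
proof (induction n)
  case (Suc n)
  have "(x + 1) ^ Suc (Suc n) \<le> (x + 1) * (x ^ Suc n + Suc n * (x + 1) ^ n)"
    using mult_left_mono[OF Suc, of "x + 1"] assms by simp
  also have "\<dots> = x ^ Suc (Suc n) + x ^ Suc n + Suc n * (x + 1) ^ Suc n"
    by (simp add: algebra_simps)
  also have "\<dots> \<le> x ^ Suc (Suc n) + (x + 1) ^ Suc n + Suc n * (x + 1) ^ Suc n"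
    using power_mono[of x "x + 1" "Suc n"] assms by simp
  finally show ?case by (simp add: algebra_simps)
qed simp

lemma root_position_le:
  assumes "m < (\<Sum>j<Suc k. (j + 1) ^ p)"
  shows "root (Suc p) (real m) \<le> real k + 1"
proof -
  have "m \<le> (k + 1) ^ Suc p" using assms sum_power_le[of p "Suc k"] by simp
  then have "real m \<le> (real k + 1) ^ Suc p"
    by (metis of_nat_1 of_nat_add of_nat_le_iff of_nat_power)
  then have "root (Suc p) (real m) \<le> root (Suc p) ((real k + 1) ^ Suc p)"
    by (rule real_root_le_mono[rotated]) simp
  also have "\<dots> = real k + 1" by (rule real_root_power_cancel) auto
  finally show ?thesis .
qed

text \<open>Raising the root \<open>s\<close> of \<open>m\<close> by 1 costs at most
  \<open>Suc p * (s + 1) ^ p\<close>. Since \<open>s \<le> k + 1\<close>, the \<open>p + 1\<close>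
  blocks in between contribute at least that much to \<open>m'\<close>.\<close>

lemma root_position_gap:
  assumes "m < (\<Sum>j<Suc k. (j + 1) ^ p)" "(\<Sum>j<k'. (j + 1) ^ p) \<le> m'" "k + p + 2 \<le> k'"
  shows "root (Suc p) (real m) + 1 \<le> root (Suc p) (real m')"
proof -
  define s where "s = root (Suc p) (real m)"
  have s0: "s \<ge> 0" and sk: "s \<le> real k + 1" and sm: "s ^ Suc p = real m"
    using root_position_le[OF assms(1)] unfolding s_def by (auto simp del: power_Suc)
  have "m + Suc p * (k + 2) ^ p \<le> m'"
    using sum_power_gap[of k "Suc p" k' p] assms by simp
  then have "real (m + Suc p * (k + 2) ^ p) \<le> real m'" by (simp only: of_nat_le_iff)
  then have "real m + Suc p * (real k + 2) ^ p \<le> real m'" by (simp add: algebra_simps)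
  moreover have "(s + 1) ^ p \<le> (real k + 2) ^ p"
    using s0 sk by (intro power_mono) auto
  then have "Suc p * (s + 1) ^ p \<le> Suc p * (real k + 2) ^ p" by (rule mult_left_mono) simp
  ultimately have "(s + 1) ^ Suc p \<le> real m'"
    using power_Suc_diff_le[OF s0, of p] sm by linarith
  then have "root (Suc p) ((s + 1) ^ Suc p) \<le> root (Suc p) (real m')"
    by (rule real_root_le_mono[rotated]) simp
  moreover have "root (Suc p) ((s + 1) ^ Suc p) = s + 1"
    using s0 by (intro real_root_power_cancel) auto
  ultimately show ?thesis unfolding s_def by (simp del: power_Suc)
qed

section \<open>Half-open boxes and their measure\<close>

definition halfopen_box :: "nat \<Rightarrow> (nat \<Rightarrow> 'n) \<Rightarrow> (nat \<Rightarrow> real) \<Rightarrow> (nat \<Rightarrow> real) \<Rightarrow> (real^'n) set" where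
  "halfopen_box d idx l u = {x. \<forall>i\<in>{1..d}. x $ idx i \<in> {l i..<u i}}"

lemma halfopen_box_borel [measurable]: "halfopen_box d (idx :: nat \<Rightarrow> 'n::finite) l u \<in> sets borel"
proof -
  have "halfopen_box d idx l u = (\<Inter>i\<in>{1..d}. {x. l i \<le> x $ idx i} \<inter> {x. x $ idx i < u i}) \<inter> UNIV"
    by (auto simp: halfopen_box_def)
  also have "\<dots> \<in> sets borel"
  proof -
    have "{x. l i \<le> x $ idx i} \<inter> {x :: real^'n. x $ idx i < u i} \<in> sets borel" for i
      by (intro sets.Int borel_closed borel_open closed_halfspace_component_ge_cart
          open_halfspace_component_lt_cart)
    then show ?thesis by (cases "d = 0") (auto intro!: sets.Int sets.finite_INT)
  qed
  finally show ?thesis .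
qed

text \<open>The set is squeezed between the open and the closed box with the same corners, which
  have equal measure. The inverse of \<open>idx\<close> turns the numbered bounds into corner
  vectors.\<close>

lemma emeasure_halfopen_box:
  fixes idx :: "nat \<Rightarrow> 'n::finite"
  assumes idx: "bij_betw idx {1..d} UNIV" and le: "\<And>i. i \<in> {1..d} \<Longrightarrow> l i \<le> u i"
  shows "emeasure lebesgue (halfopen_box d idx l u) = ennreal (\<Prod>i=1..d. u i - l i)"
proof -
  define inv where "inv = the_inv_into {1..d} idx"
  define L where "L = (\<chi> c. l (inv c))"
  define U where "U = (\<chi> c. u (inv c))"
  have inv: "inv (idx i) = i" if "i \<in> {1..d}" for i
    using idx that unfolding inv_def bij_betw_def by (simp add: the_inv_into_f_f)
  have all: "(\<forall>c. P c) \<longleftrightarrow> (\<forall>i\<in>{1..d}. P (idx i))" for P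
    using idx unfolding bij_betw_def by (metis imageE UNIV_I)
  have LU: "\<forall>c. L $ c \<le> U $ c"
    unfolding all L_def U_def using inv le by simp
  have sub: "box L U \<subseteq> halfopen_box d idx l u" "halfopen_box d idx l u \<subseteq> cbox L U"
    unfolding subset_iff mem_box_cart all halfopen_box_def L_def U_def using inv
    by (auto simp: less_imp_le)
  have ne: "L \<in> cbox L U" using LU by (simp add: mem_box_cart)
  have "measure lborel (cbox L U) = (\<Prod>c\<in>UNIV. U $ c - L $ c)"
    using content_cbox_cart[of L U] ne by auto
  also have "\<dots> = (\<Prod>i=1..d. U $ idx i - L $ idx i)"
    by (rule prod.reindex_bij_betw[OF idx, symmetric])
  also have "\<dots> = (\<Prod>i=1..d. u i - l i)"
    using inv by (intro prod.cong) (auto simp: L_def U_def)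
  finally have cbox: "emeasure lborel (cbox L U) = ennreal (\<Prod>i=1..d. u i - l i)"
    using emeasure_eq_ennreal_measure[of lborel "cbox L U"] emeasure_lborel_cbox_finite[of L U]
    by (auto simp: less_top)
  have "emeasure lborel (box L U) = emeasure lborel (cbox L U)"
    by (simp add: emeasure_lborel_box_eq emeasure_lborel_cbox_eq)
  then have "emeasure lborel (halfopen_box d idx l u) = emeasure lborel (cbox L U)"
    using emeasure_mono[OF sub(1), of lborel] emeasure_mono[OF sub(2), of lborel] by simp
  then show ?thesis using cbox by simp
qed

lemma image_halfopen_box:
  fixes idx :: "nat \<Rightarrow> 'n::finite"
  assumes idx: "bij_betw idx {1..d} UNIV" and pos: "\<And>i. u i > 0" and k: "k \<in> {1..d}"
  shows "(\<lambda>x. x $ idx k) ` halfopen_box d idx (\<lambda>_. 0) u = {0..<u k}"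
proof
  show "(\<lambda>x. x $ idx k) ` halfopen_box d idx (\<lambda>_. 0) u \<subseteq> {0..<u k}"
    using k by (auto simp: halfopen_box_def)
  show "{0..<u k} \<subseteq> (\<lambda>x. x $ idx k) ` halfopen_box d idx (\<lambda>_. 0) u"
  proof
    fix v assume v: "v \<in> {0..<u k}"
    have "idx i = idx k \<longleftrightarrow> i = k" if "i \<in> {1..d}" for i
      using bij_betw_imp_inj_on[OF idx] that k by (rule inj_on_eq_iff)
    \<comment> \<open>All other coordinates of this point are 0, which is admissible because the
      lower bounds are 0 and the upper bounds positive.\<close>
    then have "axis (idx k) v \<in> halfopen_box d idx (\<lambda>_. 0) u"
      using v pos by (auto simp: halfopen_box_def axis_def)
    moreover have "v = axis (idx k) v $ idx k" by (simp add: axis_def)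
    ultimately show "v \<in> (\<lambda>x. x $ idx k) ` halfopen_box d idx (\<lambda>_. 0) u" by blast
  qed
qed

section \<open>Rectangles with a corner at the origin\<close>

text \<open>The logarithmic side lengths on the antidiagonal \<open>t = - s\<close>, with the tuple
  as a free parameter instead of a value of \<open>Phi\<close>.\<close>

definition shape :: "real \<Rightarrow> (nat \<Rightarrow> int) \<Rightarrow> nat \<Rightarrow> real" where
  "shape s \<tau> i = (if i = 1 then s else if i = 2 then - s else of_int (\<tau> (i - 2)))"

text \<open>This makes the volume of the rectangle equal to 1.\<close>

lemma sum_shape:
  assumes "d \<ge> 3" "\<tau> \<in> zero_sum_tuples d n"
  shows "(\<Sum>i=1..d. shape s \<tau> i) = 0"
proof -
  have "{1..d} = {1,2} \<union> {3..d}" using assms by auto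
  then have "(\<Sum>i=1..d. shape s \<tau> i) = (\<Sum>i=3..d. shape s \<tau> i)"
    by (simp only:) (subst sum.union_disjoint, auto simp: shape_def)
  also have "\<dots> = (\<Sum>i=3..d. of_int (\<tau> (i - 2)))"
    by (rule sum.cong) (auto simp: shape_def)
  also have "\<dots> = (\<Sum>j=1..d-2. of_int (\<tau> j))"
    by (rule sum.reindex_bij_witness[of _ "\<lambda>j. j + 2" "\<lambda>i. i - 2"]) auto
  also have "\<dots> = of_int (\<Sum>j=1..d-2. \<tau> j)" by simp
  also have "\<dots> = 0" using assms by (simp add: zero_sum_tuples_def)
  finally show ?thesis .
qed

text \<open>Ensures that the rectangle contains the test cube of side
  \<open>2 powr (- real (d * n))\<close>. The only entries that can be negative are
  \<open>- s\<close> and the last tuple entry, which is at least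
  \<open>- (d - 3) * n\<close>.\<close>

lemma shape_ge:
  assumes "d \<ge> 4" "\<tau> \<in> zero_sum_tuples d n" "0 \<le> s" "s \<le> real (d * n)" "i \<in> {1..d}"
  shows "- real (d * n) \<le> shape s \<tau> i"
proof -
  have last: "- int (d * n) \<le> \<tau> (d - 2)"
  proof -
    have I: "{1..d-2} = insert (d - 2) {1..d-3}" using assms by auto
    have "sum \<tau> {1..d-2} = \<tau> (d - 2) + sum \<tau> {1..d-3}"
      unfolding I using assms by (subst sum.insert) auto
    moreover have "sum \<tau> {1..d-3} \<le> of_nat (card {1..d-3}) * int n"
      using assms by (intro sum_bounded_above) (auto simp: zero_sum_tuples_def)
    moreover have "of_nat (card {1..d-3}) * int n \<le> int d * int n"
      by (intro mult_right_mono) auto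
    ultimately show ?thesis using assms by (simp add: zero_sum_tuples_def)
  qed
  have "- int (d * n) \<le> \<tau> j" if "j \<in> {1..d-2}" for j
  proof (cases "j = d - 2")
    case False
    then have "j \<in> {1..d-3}" using that by auto
    then have "0 \<le> \<tau> j" using assms by (auto simp: zero_sum_tuples_def)
    then show ?thesis by (smt (verit) of_nat_0_le_iff)
  qed (use last in simp)
  moreover have "i - 2 \<in> {1..d-2}" if "i \<noteq> 1" "i \<noteq> 2" using assms(5) that by auto
  ultimately have "i \<noteq> 1 \<Longrightarrow> i \<noteq> 2 \<Longrightarrow> of_int (- int (d * n)) \<le> (of_int (\<tau> (i - 2)) :: real)"
    unfolding of_int_le_iff by blast
  then show ?thesis using assms by (auto simp: shape_def intro: order_trans[of _ 0])
qed

lemma tau_root: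
  assumes "d \<ge> 3"
  shows "tau d (root (d - 2) (real m)) = real m" "tau d (- root (d - 2) (real m)) = - real m"
proof -
  have "tau d (root (d - 2) (real m)) = real m"
    using assms by (cases "m = 0") (simp_all add: tau_def)
  then show "tau d (root (d - 2) (real m)) = real m" "tau d (- root (d - 2) (real m)) = - real m"
    by (auto simp: tau_def sgn_minus)
qed

text \<open>For \<open>s\<close> the root of \<open>m\<close>, \<open>tau\<close> sends
  \<open>s\<close> and \<open>- s\<close> to \<open>m\<close> and \<open>- m\<close>, so the maximum
  in \<open>Phi\<close> runs over the single point \<open>m\<close> and yields
  \<open>beta b m\<close>. The corner at the origin comes from choosing all
  \<open>j i = 0\<close>.\<close>

lemma standard_box_in_family:
  fixes idx :: "nat \<Rightarrow> 'n::finite"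
  assumes d: "d \<ge> 3" and idx: "bij_betw idx {1..d} UNIV"
  shows "halfopen_box d idx (\<lambda>_. 0) (\<lambda>i. 2 powr shape (root (d - 2) (real m)) (beta b m) i)
           \<in> family_E' d idx b"
proof -
  define s where "s = root (d - 2) (real m)"
  let ?R = "halfopen_box d idx (\<lambda>_. 0) (\<lambda>i. 2 powr shape s (beta b m) i)"
  have tau: "tau d s = real m" "tau d (- s) = - real m"
    using tau_root[OF d] unfolding s_def by auto
  have fl: "\<lfloor>- real m\<rfloor> = - int m" by (metis floor_of_int of_int_minus of_int_of_nat_eq)
  have "log_dims d b s (- s) = shape s (beta b m)"
    by (auto simp: fun_eq_iff log_dims_def shape_def tau fl Phi_def phi_def)
  then have "?R \<in> dyadic_intervals d idx (log_dims d b s (- s))"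
    unfolding dyadic_intervals_def halfopen_box_def by (auto intro!: exI[of _ "\<lambda>_. 0"])
  then have "?R \<in> family_E d idx b"
    unfolding family_E_def using tau by (intro UN_I[of s] UN_I[of "- s"]) auto
  moreover have "(\<lambda>x. x $ idx 1) ` ?R = {0..<2 powr s}" "(\<lambda>x. x $ idx 2) ` ?R = {0..<2 powr (- s)}"
    using image_halfopen_box[OF idx, of "\<lambda>i. 2 powr shape s (beta b m) i"] d
    by (auto simp: shape_def)
  ultimately show ?thesis
    unfolding family_E'_def s_def[symmetric] by (simp add: powr_minus)
qed

section \<open>Measurability of the maximal function\<close>

lemma countable_tau_vimage:
  assumes "d \<ge> 3"
  shows "countable {s. tau d s \<in> \<int>}"
proof -
  have "inj (tau d)"
  proof (rule injI)
    fix x y assume eq: "tau d x = tau d y"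
    have pos: "0 < \<bar>z\<bar> ^ (d - 2)" if "z \<noteq> 0" for z :: real using that by simp
    have sgn: "sgn (tau d z) = sgn z" for z
      using pos[of z] by (cases "z = 0") (simp_all add: tau_def sgn_mult)
    have "\<bar>tau d z\<bar> = \<bar>z\<bar> ^ (d - 2)" for z
      using assms by (cases "z = 0") (simp_all add: tau_def abs_mult abs_sgn_eq)
    with eq have "\<bar>x\<bar> ^ (d - 2) = \<bar>y\<bar> ^ (d - 2)" by metis
    then have "\<bar>x\<bar> = \<bar>y\<bar>"
      using assms by (subst (asm) power_eq_iff_eq_base) auto
    moreover have "sgn x = sgn y" using sgn eq by metis
    ultimately show "x = y" by (metis sgn_mult_abs)
  qed
  moreover have "{s. tau d s \<in> \<int>} = tau d -` \<int>" by auto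
  moreover have "countable (\<int> :: real set)" by (simp add: Ints_def)
  ultimately show ?thesis
    by (metis countable_image_inj_on countable_subset image_vimage_subset inj_on_subset subset_UNIV)
qed

lemma countable_dyadic_intervals: "countable (dyadic_intervals d idx a)"
proof -
  let ?F = "\<lambda>j :: nat \<Rightarrow> int. {x. \<forall>i\<in>{1..d}.
        x $ idx i \<in> {of_int (j i) * 2 powr a i ..< (of_int (j i) + 1) * 2 powr a i}}"
  \<comment> \<open>There are uncountably many functions \<open>j\<close>, but the interval depends
    only on the values of \<open>j\<close> on \<open>{1..d}\<close>.\<close>
  have "dyadic_intervals d idx a \<subseteq> ?F ` ({1..d} \<rightarrow>\<^sub>E UNIV)"
  proof
    fix R assume "R \<in> dyadic_intervals d idx a"
    then obtain j where "R = ?F j" unfolding dyadic_intervals_def by blast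
    also have "?F j = ?F (restrict j {1..d})" by simp
    finally show "R \<in> ?F ` ({1..d} \<rightarrow>\<^sub>E UNIV)" by (rule image_eqI[where x = "restrict j {1..d}"]) simp
  qed
  moreover have "countable ({1..d} \<rightarrow>\<^sub>E (UNIV :: int set))"
    by (intro countable_PiE) simp_all
  ultimately show ?thesis by (meson countable_image countable_subset)
qed

lemma countable_family_E':
  assumes "d \<ge> 3"
  shows "countable (family_E' d idx b)"
proof -
  have "countable (family_E d idx b)"
    unfolding family_E_def
    by (intro countable_UN countable_tau_vimage countable_dyadic_intervals assms)
  then show ?thesis by (rule countable_subset[rotated]) (auto simp: family_E'_def)
qed

lemma family_E'_borel:
  fixes idx :: "nat \<Rightarrow> 'n::finite"
  assumes "R \<in> family_E' d idx b"
  shows "R \<in> sets borel"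
proof -
  obtain a where "R \<in> dyadic_intervals d idx a"
    using assms unfolding family_E'_def family_E_def by auto
  then obtain l u where "R = halfopen_box d idx l u"
    unfolding dyadic_intervals_def halfopen_box_def by auto
  then show ?thesis by simp
qed

lemma maximal_op_measurable:
  fixes idx :: "nat \<Rightarrow> 'n::finite"
  assumes "d \<ge> 3"
  shows "maximal_op (family_E' d idx b) f \<in> borel_measurable lebesgue"
proof -
  have "(\<lambda>x. indicator R x / emeasure lebesgue R * (\<integral>\<^sup>+y\<in>R. ennreal \<bar>f y\<bar> \<partial>lebesgue))
          \<in> borel_measurable lebesgue" if "R \<in> family_E' d idx b" for R
  proof -
    have [measurable]: "R \<in> sets lebesgue" using family_E'_borel[OF that] by simp
    show ?thesis by (simp add: divide_ennreal_def)
  qed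
  then have "(\<lambda>x. SUP R\<in>family_E' d idx b.
        indicator R x / emeasure lebesgue R * (\<integral>\<^sup>+y\<in>R. ennreal \<bar>f y\<bar> \<partial>lebesgue))
          \<in> borel_measurable lebesgue"
    by (intro borel_measurable_SUP countable_family_E' assms)
  then show ?thesis unfolding maximal_op_def[abs_def] .
qed

section \<open>Lower bound for the level set\<close>

lemma one_le_maximal_op:
  fixes f :: "real^'n::finite \<Rightarrow> real"
  assumes "R \<in> F" "x \<in> R" "emeasure lebesgue R = 1" "Q \<subseteq> R"
    and "1 \<le> (\<integral>\<^sup>+y\<in>Q. ennreal \<bar>f y\<bar> \<partial>lebesgue)"
  shows "1 \<le> maximal_op F f x"
proof -
  have "(\<integral>\<^sup>+y\<in>Q. ennreal \<bar>f y\<bar> \<partial>lebesgue) \<le> (\<integral>\<^sup>+y\<in>R. ennreal \<bar>f y\<bar> \<partial>lebesgue)"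
    using assms(4) by (intro nn_integral_mono) (auto simp: indicator_def)
  also have "\<dots> = indicator R x / emeasure lebesgue R * (\<integral>\<^sup>+y\<in>R. ennreal \<bar>f y\<bar> \<partial>lebesgue)"
    using assms(2,3) by simp
  also have "\<dots> \<le> maximal_op F f x"
    unfolding maximal_op_def using assms(1) by (rule SUP_upper)
  finally show ?thesis using assms(5) by (rule order_trans[rotated])
qed

text \<open>Rectangles with a corner at the origin all overlap there; keeping the upper half in
  every coordinate allows them to be separated at the cost of a factor \<open>2 ^ d\<close> in
  measure.\<close>

definition upper_part :: "nat \<Rightarrow> (nat \<Rightarrow> 'n) \<Rightarrow> (nat \<Rightarrow> real) \<Rightarrow> (real^'n) set" where
  "upper_part d idx a = halfopen_box d idx (\<lambda>i. 2 powr (a i - 1)) (\<lambda>i. 2 powr a i)"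

lemma emeasure_upper_part:
  fixes idx :: "nat \<Rightarrow> 'n::finite"
  assumes "bij_betw idx {1..d} UNIV" "(\<Sum>i=1..d. a i) = 0"
  shows "emeasure lebesgue (upper_part d idx a) = ennreal (1 / 2 ^ d)"
proof -
  have "(\<Prod>i=1..d. 2 powr a i - 2 powr (a i - 1)) = (\<Prod>i=1..d. 2 powr a i * (1 / 2) :: real)"
    by (intro prod.cong) (auto simp: powr_diff)
  also have "\<dots> = 2 powr (\<Sum>i=1..d. a i) * (1 / 2) ^ d"
    by (simp only: prod.distrib powr_sum prod_constant) (simp add: powr_sum)
  finally show ?thesis
    unfolding upper_part_def using assms
    by (subst emeasure_halfopen_box) (auto simp: power_one_over)
qed

text \<open>The exponents are real, so being different is not enough: a gap of 1 puts the lower end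
  of one side at or above the upper end of the other.\<close>

lemma upper_part_disjoint:
  assumes "i \<in> {1..d}" "a i + 1 \<le> a' i"
  shows "upper_part d idx a \<inter> upper_part d idx a' = {}"
proof -
  have "x $ idx i < 2 powr a i \<and> 2 powr (a' i - 1) \<le> x $ idx i"
    if "x \<in> upper_part d idx a" "x \<in> upper_part d idx a'" for x
    using that assms(1) by (auto simp: upper_part_def halfopen_box_def)
  moreover have "2 powr a i \<le> 2 powr (a' i - 1)" using assms(2) by simp
  ultimately show ?thesis by (meson disjoint_iff less_le_trans not_less)
qed

text \<open>A rectangle is indexed by a pair \<open>(i, \<tau>)\<close>: the block number
  \<open>K i\<close> controls the first two sides and \<open>\<tau>\<close> gives the others. Pairs
  with the same tuple are separated in the first coordinate, all others in a coordinate where the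
  tuples differ.\<close>

lemma level_set_lower_bound:
  fixes idx :: "nat \<Rightarrow> 'n::finite"
  assumes d: "d \<ge> 4" and idx: "bij_betw idx {1..d} UNIV" and b: "block_enumeration d b"
    and n: "n \<ge> 1"
    and Q: "Q = halfopen_box d idx (\<lambda>_. 0) (\<lambda>_. 2 powr (- real (d * n)))"
    and f: "1 \<le> (\<integral>\<^sup>+y\<in>Q. ennreal \<bar>f y\<bar> \<partial>lebesgue)"
  shows "ennreal (real n ^ (d - 2) / 2 ^ d)
           \<le> emeasure lebesgue {x. maximal_op (family_E' d idx b) f x \<ge> 1}"
proof -
  \<comment> \<open>Consecutive blocks used are \<open>d - 1\<close> apart, the spacing required by \<open>root_position_gap\<close>.\<close>
  define K where "K = (\<lambda>i. n + (d - 1) * i)"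
  define I where "I = {..<n} \<times> zero_sum_tuples d n"
  have mono: "zero_sum_tuples d n \<subseteq> zero_sum_tuples d (K i)" for i
  proof -
    have "int n \<le> int (K i)" by (simp add: K_def)
    then show ?thesis by (fastforce simp: zero_sum_tuples_def)
  qed
  have "\<exists>m. (\<Sum>j<K i. (j + 1) ^ (d - 3)) \<le> m \<and> m < (\<Sum>j<Suc (K i). (j + 1) ^ (d - 3)) \<and> beta b m = \<tau>"
    if "(i, \<tau>) \<in> I" for i \<tau>
    using beta_position[OF _ b, of \<tau> "K i"] that mono d unfolding I_def by auto
  then obtain m where m: "\<And>i \<tau>. (i, \<tau>) \<in> I \<Longrightarrow> (\<Sum>j<K i. (j + 1) ^ (d - 3)) \<le> m i \<tau>"
      "\<And>i \<tau>. (i, \<tau>) \<in> I \<Longrightarrow> m i \<tau> < (\<Sum>j<Suc (K i). (j + 1) ^ (d - 3))"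
      "\<And>i \<tau>. (i, \<tau>) \<in> I \<Longrightarrow> beta b (m i \<tau>) = \<tau>"
    by metis
  define s where "s = (\<lambda>i \<tau>. root (d - 2) (real (m i \<tau>)))"
  have D: "d - 2 = Suc (d - 3)" using d by simp
  have s0: "0 \<le> s i \<tau>" for i \<tau> by (simp add: s_def real_root_pos_pos_le)
  have s_le: "s i \<tau> \<le> real (d * n)" if "(i, \<tau>) \<in> I" for i \<tau>
  proof -
    have "s i \<tau> \<le> real (K i) + 1"
      unfolding s_def D by (rule root_position_le) (use m(2) that in auto)
    \<comment> \<open>As \<open>i < n\<close>, the last block used has number at most
      \<open>d * n - 1\<close>; this fixes the exponent \<open>d * n\<close> in the side of
      \<open>Q\<close>.\<close>
    moreover have "K i + 1 \<le> d * n"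
    proof -
      have "(d - 1) * (i + 1) \<le> (d - 1) * n" using that by (intro mult_left_mono) (auto simp: I_def)
      moreover have "(d - 1) * n + n = d * n" using d by (cases d) auto
      ultimately show ?thesis using d by (simp add: K_def)
    qed
    then have "real (K i) + 1 \<le> real (d * n)" by linarith
    ultimately show ?thesis by linarith
  qed
  have s_gap: "s i \<tau> + 1 \<le> s i' \<tau>" if "(i, \<tau>) \<in> I" "(i', \<tau>) \<in> I" "i < i'" for i i' \<tau>
    unfolding s_def D
  proof (rule root_position_gap)
    have "(d - 1) * (i + 1) \<le> (d - 1) * i'" using that by (intro mult_left_mono) auto
    then show "K i + (d - 3) + 2 \<le> K i'" using d by (simp add: K_def)
  qed (use that m in auto)
  define a where "a = (\<lambda>(i, \<tau>). shape (s i \<tau>) \<tau>)"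
  let ?E = "\<lambda>p. upper_part d idx (a p)"
  let ?S = "{x. maximal_op (family_E' d idx b) f x \<ge> 1}"
  have a0: "(\<Sum>i=1..d. a p i) = 0" if "p \<in> I" for p
    using that d sum_shape[of d _ n] by (auto simp: a_def I_def)
  have "?E p \<subseteq> ?S" if "p \<in> I" for p
  proof
    fix x assume x: "x \<in> ?E p"
    obtain i \<tau> where p: "p = (i, \<tau>)" by (cases p)
    let ?R = "halfopen_box d idx (\<lambda>_. 0) (\<lambda>j. 2 powr a p j)"
    have "1 \<le> maximal_op (family_E' d idx b) f x"
    proof (rule one_le_maximal_op[OF _ _ _ _ f])
      show "?R \<in> family_E' d idx b"
        using standard_box_in_family[OF _ idx, of "m i \<tau>" b] d m(3)[of i \<tau>] that
        by (simp add: p a_def s_def)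
      show "x \<in> ?R"
        using x by (auto simp: upper_part_def halfopen_box_def intro: order_trans[OF powr_ge_zero])
      show "emeasure lebesgue ?R = 1"
        using a0[OF that] by (subst emeasure_halfopen_box[OF idx]) (auto simp flip: powr_sum)
      have "- real (d * n) \<le> a p j" if "j \<in> {1..d}" for j
        using shape_ge[OF d _ s0 s_le that, of \<tau> i \<tau>] \<open>p \<in> I\<close> by (simp add: p a_def I_def)
      then have "2 powr (- real (d * n)) \<le> 2 powr a p j" if "j \<in> {1..d}" for j
        using that by simp
      then show "Q \<subseteq> ?R"
        unfolding Q halfopen_box_def by (force intro: less_le_trans)
    qed
    then show "x \<in> ?S" by simp
  qed
  then have sub: "(\<Union>p\<in>I. ?E p) \<subseteq> ?S" by blast
  have disj: "disjoint_family_on ?E I"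
    unfolding disjoint_family_on_def
  proof (intro ballI impI)
    fix p q assume pq: "p \<in> I" "q \<in> I" "p \<noteq> q"
    obtain i \<tau> where p: "p = (i, \<tau>)" by (cases p)
    obtain i' \<tau>' where q: "q = (i', \<tau>')" by (cases q)
    have "\<exists>k\<in>{1..d}. a p k + 1 \<le> a q k \<or> a q k + 1 \<le> a p k"
    proof (cases "\<tau> = \<tau>'")
      case True
      then have "i < i' \<or> i' < i" using pq p q by auto
      then have "a p 1 + 1 \<le> a q 1 \<or> a q 1 + 1 \<le> a p 1"
        using s_gap pq True unfolding p q a_def by (auto simp: shape_def)
      then show ?thesis using d by (intro bexI[of _ 1]) auto
    next
      case False
      have "\<tau> \<in> {1..d-2} \<rightarrow>\<^sub>E UNIV" "\<tau>' \<in> {1..d-2} \<rightarrow>\<^sub>E UNIV"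
        using pq unfolding p q I_def zero_sum_tuples_def by auto
      with False obtain j where j: "j \<in> {1..d-2}" "\<tau> j \<noteq> \<tau>' j" by (meson PiE_ext)
      then have "\<tau> j + 1 \<le> \<tau>' j \<or> \<tau>' j + 1 \<le> \<tau> j" by linarith
      then have "of_int (\<tau> j + 1) \<le> (of_int (\<tau>' j) :: real) \<or> of_int (\<tau>' j + 1) \<le> (of_int (\<tau> j) :: real)"
        unfolding of_int_le_iff .
      then have "a p (j + 2) + 1 \<le> a q (j + 2) \<or> a q (j + 2) + 1 \<le> a p (j + 2)"
        using j unfolding p q a_def by (auto simp: shape_def)
      then show ?thesis using j d by (intro bexI[of _ "j + 2"]) auto
    qed
    then show "?E p \<inter> ?E q = {}"
      using upper_part_disjoint[of _ d "a p" "a q" idx] upper_part_disjoint[of _ d "a q" "a p" idx]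
      by blast
  qed
  have card: "card I = n * (n + 1) ^ (d - 3)"
    unfolding I_def using d by (simp add: card_cartesian_product card_zero_sum_tuples)
  \<comment> \<open>Infinite sets have cardinality 0, so the positive value just computed gives
    finiteness.\<close>
  then have fin: "finite I" using n by (intro card_ge_0_finite) simp
  have "n ^ (d - 2) \<le> card I"
    unfolding card D using power_mono[of n "n + 1" "d - 3"] by simp
  then have "real n ^ (d - 2) \<le> real (card I)" by (metis of_nat_le_iff of_nat_power)
  then have "ennreal (real n ^ (d - 2) / 2 ^ d) \<le> ennreal (real (card I) * (1 / 2 ^ d))"
    by (intro ennreal_leI) (simp add: divide_right_mono)
  also have "\<dots> = (\<Sum>p\<in>I. ennreal (1 / 2 ^ d))"
    by (subst ennreal_mult) (simp_all add: ennreal_of_nat_eq_real_of_nat)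
  also have "\<dots> = (\<Sum>p\<in>I. emeasure lebesgue (?E p))"
    using a0 by (intro sum.cong) (auto simp: emeasure_upper_part[OF idx])
  also have "\<dots> = emeasure lebesgue (\<Union>p\<in>I. ?E p)"
    using disj fin by (intro sum_emeasure) (auto simp: upper_part_def)
  also have "\<dots> \<le> emeasure lebesgue ?S"
  \<comment> \<open>Monotonicity needs the level set to be measurable, since \<open>emeasure\<close>
    is 0 on non-measurable sets.\<close>
  proof (rule emeasure_mono[OF sub])
    have "maximal_op (family_E' d idx b) f \<in> borel_measurable lebesgue"
      using d by (intro maximal_op_measurable) simp
    then have "maximal_op (family_E' d idx b) f -` {1..} \<inter> space lebesgue \<in> sets lebesgue"
      by (rule measurable_sets) simp
    then show "?S \<in> sets lebesgue" by (simp add: vimage_def)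
  qed
  finally show ?thesis .
qed

section \<open>Comparison of growth rates\<close>

text \<open>For \<open>N \<ge> 2\<close> both \<open>exp 1\<close> and \<open>2 ^ N\<close> are at
  most \<open>exp N\<close>, and \<open>2 * exp N \<le> exp (2 * N)\<close>.\<close>

lemma ln_exp_add_power2_le:
  fixes N :: nat
  assumes "N \<ge> 2"
  shows "1 \<le> ln (exp 1 + 2 ^ N :: real)" "ln (exp 1 + 2 ^ N :: real) \<le> 2 * real N"
proof -
  have "ln (exp 1 :: real) \<le> ln (exp 1 + 2 ^ N)"
    by (subst ln_le_cancel_iff) (auto intro: add_pos_pos)
  then show "1 \<le> ln (exp 1 + 2 ^ N :: real)" by simp
  have "exp 1 \<le> (3::real)" using exp_le by simp
  moreover have "2 ^ N \<le> exp (real N)"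
    using power_mono[of 2 "exp 1 :: real" N] exp_ge_add_one_self[of 1]
    by (simp add: exp_of_nat_mult[symmetric])
  moreover have "exp 2 \<le> exp (real N)" using assms by simp
  moreover have "(3::real) \<le> exp 2" using exp_ge_add_one_self[of "2::real"] by simp
  moreover have "exp (real N) * 2 \<le> exp (real N) * exp (real N)"
    using \<open>exp 2 \<le> _\<close> \<open>3 \<le> exp 2\<close> by (intro mult_left_mono) linarith+
  moreover have "exp (real N) * exp (real N) = exp (2 * real N)"
    by (simp flip: exp_add)
  ultimately have "exp 1 + 2 ^ N \<le> exp (2 * real N)" by linarith
  then have "ln (exp 1 + 2 ^ N) \<le> ln (exp (2 * real N))"
    by (subst ln_le_cancel_iff) (auto intro: add_pos_pos)
  then show "ln (exp 1 + 2 ^ N :: real) \<le> 2 * real N" by simp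
qed

text \<open>If \<open>p > q\<close>, then \<open>A * n powr (q - p)\<close> would tend to 0 while
  staying at least 1.\<close>

lemma powr_domination_exponent_le:
  fixes p q A :: real
  assumes "\<And>n::nat. n \<ge> 1 \<Longrightarrow> real n powr p \<le> A * real n powr q"
  shows "p \<le> q"
proof (rule ccontr)
  assume "\<not> p \<le> q"
  then have "(\<lambda>n. A * real n powr (q - p)) \<longlonglongrightarrow> A * 0"
    by (intro tendsto_mult tendsto_const tendsto_neg_powr filterlim_real_sequentially) auto
  moreover have "1 \<le> A * real n powr (q - p)" if "n \<ge> 1" for n :: nat
    using assms[OF that] that by (simp add: powr_diff field_simps)
  ultimately have "1 \<le> A * 0" by (intro LIMSEQ_le_const) auto
  then show False by simp
qed

theorem theorem2p1:
  fixes d :: nat and idx :: "nat \<Rightarrow> 'n::finite"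
    and b :: "nat \<Rightarrow> (nat \<Rightarrow> int) list" and \<alpha> :: real
  assumes "d \<ge> 4"
    and "bij_betw idx {1..d} UNIV"
    and "block_enumeration d b"
    and "\<exists>C::real. C > 0 \<and>
          (\<forall>f :: real^'n \<Rightarrow> real. f \<in> borel_measurable lebesgue \<longrightarrow> (\<forall>x. f x \<ge> 0) \<longrightarrow>
             emeasure lebesgue {x. maximal_op (family_E' d idx b) f x \<ge> 1}
               \<le> ennreal C * (\<integral>\<^sup>+x. ennreal (f x * (ln (exp 1 + f x)) powr \<alpha>) \<partial>lebesgue))"
  shows "\<alpha> \<ge> real d - 2"
proof -
  note d = assms(1) and idx = assms(2) and b = assms(3)
  from assms(4) obtain C :: real where C: "C > 0" and
    weak: "\<And>f :: real^'n \<Rightarrow> real. f \<in> borel_measurable lebesgue \<Longrightarrow> (\<And>x. f x \<ge> 0) \<Longrightarrow>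
             emeasure lebesgue {x. maximal_op (family_E' d idx b) f x \<ge> 1}
               \<le> ennreal C * (\<integral>\<^sup>+x. ennreal (f x * (ln (exp 1 + f x)) powr \<alpha>) \<partial>lebesgue)"
    by blast
  \<comment> \<open>For negative \<open>\<alpha>\<close> the upper bound on the logarithm is of no use, but the logarithm is at least 1.\<close>
  define \<gamma> where "\<gamma> = max \<alpha> 0"
  \<comment> \<open>The factor \<open>2 ^ d\<close> undoes the loss from the upper parts, and the
    last factor is what remains of \<open>(2 * N) powr \<gamma>\<close> once
    \<open>n powr \<gamma>\<close> is split off.\<close>
  define A where "A = 2 ^ d * C * (2 * real (d * d)) powr \<gamma>"
  have "real n powr (real d - 2) \<le> A * real n powr \<gamma>" if n: "n \<ge> 1" for n :: nat
  proof -
    \<comment> \<open>The cube has \<open>d\<close> sides of length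
      \<open>2 powr (- real (d * n))\<close>, hence measure \<open>1 / 2 ^ N\<close>, and
      \<open>f\<close> has integral 1.\<close>
    define N where "N = d * d * n"
    define Q where "Q = halfopen_box d idx (\<lambda>_. 0) (\<lambda>_. 2 powr (- real (d * n)))"
    define f :: "real^'n \<Rightarrow> real" where "f = (\<lambda>x. 2 ^ N * indicator Q x)"
    have Qm [measurable]: "Q \<in> sets lebesgue" unfolding Q_def by simp
    have "(\<Prod>i=1..d. 2 powr (- real (d * n)) - 0 :: real) = 1 / 2 ^ N"
      by (simp only: powr_minus powr_realpow zero_less_numeral)
        (simp add: N_def inverse_eq_divide power_one_over ac_simps flip: power_mult)
    then have Q: "emeasure lebesgue Q = ennreal (1 / 2 ^ N)"
      unfolding Q_def by (subst emeasure_halfopen_box[OF idx]) auto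
    \<comment> \<open>Used with \<open>c = 1\<close> for the mass of \<open>f\<close> and with
      \<open>c\<close> the power of the logarithm for the right-hand side of the inequality.\<close>
    have scaled: "(\<integral>\<^sup>+x. ennreal (2 ^ N * c * indicator Q x) \<partial>lebesgue) = ennreal c" if "c \<ge> 0" for c
    proof -
      have "(\<integral>\<^sup>+x. ennreal (2 ^ N * c * indicator Q x) \<partial>lebesgue)
              = (\<integral>\<^sup>+x. ennreal (2 ^ N * c) * indicator Q x \<partial>lebesgue)"
        by (intro nn_integral_cong) (auto simp: indicator_def)
      also have "\<dots> = ennreal (2 ^ N * c) * ennreal (1 / 2 ^ N)"
        using Q by (simp add: nn_integral_cmult_indicator)
      also have "\<dots> = ennreal c" using that by (simp flip: ennreal_mult)
      finally show ?thesis .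
    qed
    let ?l = "ln (exp 1 + 2 ^ N :: real)"
    have "(\<integral>\<^sup>+y\<in>Q. ennreal \<bar>f y\<bar> \<partial>lebesgue) = (\<integral>\<^sup>+x. ennreal (2 ^ N * 1 * indicator Q x) \<partial>lebesgue)"
      by (intro nn_integral_cong) (auto simp: f_def indicator_def)
    then have "1 \<le> (\<integral>\<^sup>+y\<in>Q. ennreal \<bar>f y\<bar> \<partial>lebesgue)" using scaled[of 1] by simp
    from level_set_lower_bound[OF d idx b n Q_def this]
    have "ennreal (real n ^ (d - 2) / 2 ^ d)
            \<le> ennreal C * (\<integral>\<^sup>+x. ennreal (f x * (ln (exp 1 + f x)) powr \<alpha>) \<partial>lebesgue)"
      using weak[of f] by (rule order_trans) (auto simp: f_def)
    also have "(\<integral>\<^sup>+x. ennreal (f x * (ln (exp 1 + f x)) powr \<alpha>) \<partial>lebesgue)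
                 = (\<integral>\<^sup>+x. ennreal (2 ^ N * ?l powr \<alpha> * indicator Q x) \<partial>lebesgue)"
      by (intro nn_integral_cong) (auto simp: f_def indicator_def)
    also have "\<dots> = ennreal (?l powr \<alpha>)" by (rule scaled) simp
    also have "ennreal C * ennreal (?l powr \<alpha>) = ennreal (C * ?l powr \<alpha>)"
      using C by (simp add: ennreal_mult)
    finally have "real n ^ (d - 2) / 2 ^ d \<le> C * ?l powr \<alpha>"
      using C by (simp add: ennreal_le_iff)
    moreover have "?l powr \<alpha> \<le> (2 * real N) powr \<gamma>"
    proof -
      have "N \<ge> 2"
        using mult_le_mono[OF mult_le_mono[OF d d] n] by (simp add: N_def)
      note l = ln_exp_add_power2_le[OF this]
      have "?l powr \<alpha> \<le> ?l powr \<gamma>" using l by (intro powr_mono) (auto simp: \<gamma>_def)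
      also have "\<dots> \<le> (2 * real N) powr \<gamma>" using l by (intro powr_mono2) (auto simp: \<gamma>_def)
      finally show ?thesis .
    qed
    then have "C * ?l powr \<alpha> \<le> C * (2 * real N) powr \<gamma>" using C by simp
    ultimately have "real n ^ (d - 2) / 2 ^ d \<le> C * (2 * real N) powr \<gamma>" by linarith
    then have "real n ^ (d - 2) \<le> 2 ^ d * (C * (2 * real N) powr \<gamma>)"
      by (simp add: field_simps)
    also have "\<dots> = A * real n powr \<gamma>"
      unfolding A_def N_def by (simp add: powr_mult)
    also have "real n ^ (d - 2) = real n powr (real d - 2)"
      using d n by (simp add: powr_realpow[symmetric] of_nat_diff)
    finally show ?thesis .
  qed
  then have "real d - 2 \<le> \<gamma>" by (rule powr_domination_exponent_le)
  \<comment> \<open>Since \<open>real d - 2\<close> is positive, \<gamma> is not 0 and therefore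
    equals \<alpha>.\<close>
  then show ?thesis using d by (simp add: \<gamma>_def max_def split: if_splits)
qed

end
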